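(* Let $\mathscr A$ be a $C^*$-algebra, let $\mathscr E$ be a Hilbert $C^*$-module over $\mathscr A$, and let $(\mathscr H,\mathscr K)$ be a separated pair of orthogonally complemented submodules of $\mathscr E$. Let $\Pi_1$ and $\Pi_2$ be idempotents in $\mathcal L(\mathscr E)$ such that $\mathscr R(\Pi_1)=\mathscr H$ and $\mathscr R(\Pi_2)=\mathscr K$. Then the following assertions are equivalent: (i) $\mathscr R(\Pi_1+\lambda\Pi_2)$ is closed in $\mathscr E$ for every $\lambda\in\mathbb C$; (ii) $\mathscr R(\Pi_1+\lambda\Pi_2)$ is closed in $\mathscr E$ for some $\lambda\in\mathbb C\setminus\{0\}$; (iii) $\mathscr R(\Pi_1+\Pi_2)$ is closed in $\mathscr E$.
   Context: $\mathcal L(\mathscr E)$ is the set of all adjointable operators on $\mathscr E$; $\mathscr R(T)$ denotes the range of $T$. An idempotent is an operator $\Pi$ with $\Pi^2=\Pi$ (not necessarily self-adjoint). For a submodule $\mathscr M\subseteq\mathscr E$, $\mathscr M^\perp=\{x\in\mathscr E:\langle x,y\rangle=0\text{ for all }y\in\mathscr M\}$, and $\mathscr M$ is orthogonally complemented in $\mathscr E$ if $\mathscr M\oplus\mathscr M^\perp=\mathscr E$ (in which case $\mathscr M$ is closed). A pair $(\mathscr H,\mathscr K)$ of closed submodules of $\mathscr E$ is a separated pair if $\mathscr H\cap\mathscr K=0$ and $\mathscr H+\mathscr K$ is orthogonally complemented in $\mathscr E$. *)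

theory Defs
  imports "HOL-Analysis.Analysis"
begin

class complex_normed_vector = real_normed_vector +
  fixes scaleC :: "complex \<Rightarrow> 'a \<Rightarrow> 'a"  (infixr "*\<^sub>C" 75)
  assumes scaleC_add_right: "c *\<^sub>C (x + y) = c *\<^sub>C x + c *\<^sub>C y"
    and scaleC_add_left: "(c + d) *\<^sub>C x = c *\<^sub>C x + d *\<^sub>C x"
    and scaleC_scaleC: "c *\<^sub>C (d *\<^sub>C x) = (c * d) *\<^sub>C x"
    and scaleR_eq_scaleC: "r *\<^sub>R x = complex_of_real r *\<^sub>C x"
    and norm_scaleC: "norm (c *\<^sub>C x) = cmod c * norm x"

text \<open>No unit is required: \<open>real_normed_algebra\<close> does not include one.\<close>

class cstar_algebra = complex_normed_vector + real_normed_algebra + banach +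
  fixes star :: "'a \<Rightarrow> 'a"
  assumes mult_scaleC_left: "(c *\<^sub>C x) * y = c *\<^sub>C (x * y)"
    and mult_scaleC_right: "x * (c *\<^sub>C y) = c *\<^sub>C (x * y)"
    and star_star: "star (star x) = x"
    and star_add: "star (x + y) = star x + star y"
    and star_scaleC: "star (c *\<^sub>C x) = cnj c *\<^sub>C star x"
    and star_mult: "star (x * y) = star y * star x"
    and cstar_identity: "norm (star x * x) = (norm x)\<^sup>2"

definition cstar_positive :: "'a::cstar_algebra \<Rightarrow> bool" where
  "cstar_positive a \<longleftrightarrow> (\<exists>b. a = star b * b)"

text \<open>
  Right modules, with the inner product linear in its second argument. The norm of the
  type \<open>'e\<close> is forced by \<open>norm_eq_ip\<close> to be the one induced by the inner product; its
  completeness, which makes the module a Hilbert module, comes from the class \<open>banach\<close>.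
\<close>

locale hilbert_cstar_module =
  fixes act :: "'e::{complex_normed_vector,banach} \<Rightarrow> 'a::cstar_algebra \<Rightarrow> 'e"
    and ip :: "'e \<Rightarrow> 'e \<Rightarrow> 'a"
  assumes act_add_left: "act (x + y) a = act x a + act y a"
    and act_add_right: "act x (a + b) = act x a + act x b"
    and act_mult: "act x (a * b) = act (act x a) b"
    and act_scaleC_left: "act (c *\<^sub>C x) a = c *\<^sub>C act x a"
    and act_scaleC_right: "act x (c *\<^sub>C a) = c *\<^sub>C act x a"
    and ip_add_right: "ip x (y + z) = ip x y + ip x z"
    and ip_scaleC_right: "ip x (c *\<^sub>C y) = c *\<^sub>C ip x y"
    and ip_act_right: "ip x (act y a) = ip x y * a"
    and ip_star: "star (ip x y) = ip y x"
    and ip_positive: "cstar_positive (ip x x)"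
    and ip_definite: "ip x x = 0 \<Longrightarrow> x = 0"
    and norm_eq_ip: "norm x = sqrt (norm (ip x x))"

definition submodule ::
  "('e::complex_normed_vector \<Rightarrow> 'a \<Rightarrow> 'e) \<Rightarrow> 'e set \<Rightarrow> bool" where
  "submodule act M \<longleftrightarrow>
     0 \<in> M \<and> (\<forall>x\<in>M. \<forall>y\<in>M. x + y \<in> M) \<and> (\<forall>c. \<forall>x\<in>M. c *\<^sub>C x \<in> M) \<and>
     (\<forall>a. \<forall>x\<in>M. act x a \<in> M)"

definition orth_compl :: "('e \<Rightarrow> 'e \<Rightarrow> 'a::zero) \<Rightarrow> 'e set \<Rightarrow> 'e set" where
  "orth_compl ip M = {x. \<forall>y\<in>M. ip x y = 0}"

definition subspace_sum :: "'e::plus set \<Rightarrow> 'e set \<Rightarrow> 'e set" where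
  "subspace_sum M N = {x + y |x y. x \<in> M \<and> y \<in> N}"

text \<open>The sum of a submodule and its orthogonal complement is direct by definiteness of \<open>ip\<close>.\<close>

definition orth_complemented ::
  "('e::complex_normed_vector \<Rightarrow> 'a::zero \<Rightarrow> 'e) \<Rightarrow> ('e \<Rightarrow> 'e \<Rightarrow> 'a) \<Rightarrow> 'e set \<Rightarrow> bool" where
  "orth_complemented act ip M \<longleftrightarrow>
     submodule act M \<and> subspace_sum M (orth_compl ip M) = UNIV"

definition separated_pair ::
  "('e::complex_normed_vector \<Rightarrow> 'a::zero \<Rightarrow> 'e) \<Rightarrow> ('e \<Rightarrow> 'e \<Rightarrow> 'a) \<Rightarrow> 'e set \<Rightarrow> 'e set \<Rightarrow> bool"
where
  "separated_pair act ip H K \<longleftrightarrow>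
     submodule act H \<and> closed H \<and> submodule act K \<and> closed K \<and>
     H \<inter> K = {0} \<and> orth_complemented act ip (subspace_sum H K)"

text \<open>Linearity and boundedness of adjointable maps are consequences, not assumptions.\<close>

definition adjointable :: "('e \<Rightarrow> 'e \<Rightarrow> 'a) \<Rightarrow> ('e \<Rightarrow> 'e) \<Rightarrow> bool" where
  "adjointable ip T \<longleftrightarrow> (\<exists>S. \<forall>x y. ip (T x) y = ip x (S y))"

definition idempotent :: "('e \<Rightarrow> 'e) \<Rightarrow> bool" where
  "idempotent P \<longleftrightarrow> P \<circ> P = P"

end

theory Submission
  imports Defs
begin

text \<open>
  The theorem is about the direct sum \<open>H + K\<close>, which is closed in the Hilbert module. For \<open>c \<noteq> 0\<close> the map \<open>h + k \<mapsto> h + c *\<^sub>C k\<close> is a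
  well-defined linear bijection of \<open>H + K\<close> because \<open>H \<inter> K = {0}\<close>, and it carries the range of
  \<open>P1 + P2\<close> onto the range of \<open>P1 + c *\<^sub>C P2\<close>. It is a homeomorphism as soon as the two
  components \<open>h\<close> and \<open>k\<close> depend continuously on \<open>h + k\<close>; then one of these ranges is closed
  if and only if the other is. For \<open>c = 0\<close> the range is \<open>H\<close>, which is closed.

  The continuity of the components is \<open>direct_sum_components_bounded\<close>: addition maps the Banach
  space \<open>H \<times> K\<close> onto \<open>H + K\<close>, which is a Banach space too, so the open mapping theorem
  bounds \<open>(h, k)\<close> by a multiple of \<open>h + k\<close>. The open mapping theorem is derived here from the
  Baire category theorem, in the quantitative form \<open>open_mapping_closed_image\<close>.

  That \<open>H + K\<close> is closed follows from its being orthogonally complemented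
  (\<open>orth_complemented_closed\<close>): since \<open>norm (g - u) = norm (g + u)\<close> for orthogonal \<open>g\<close> and \<open>u\<close>,
  a nonzero vector orthogonal to a submodule cannot be approximated from that submodule.
\<close>

section \<open>The open mapping theorem\<close>

text \<open>
  Approximate preimages can be corrected to exact ones: solve approximately, then solve again
  for the remaining error, and so on. The errors halve at each step, so the corrections form an
  absolutely convergent series whose sum has at most twice the norm bound of its first term.
\<close>

lemma exact_preimage_from_approximate:
  fixes f :: "'a::banach \<Rightarrow> 'b::real_normed_vector"
  assumes f: "bounded_linear f" and S: "subspace S" "closed S"
    and approx: "\<And>y. y \<in> f ` S \<Longrightarrow> \<exists>x\<in>S. norm x \<le> M * norm y \<and> norm (y - f x) \<le> norm y / 2"
    and y: "y \<in> f ` S"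
  shows "\<exists>x\<in>S. f x = y \<and> norm x \<le> 2 * M * norm y"
proof -
  interpret f: bounded_linear f by (rule f)
  have Y: "subspace (f ` S)"
    using S(1) f.linear_axioms by (simp add: linear_subspace_image)
  obtain g where gS: "\<And>y. y \<in> f ` S \<Longrightarrow> g y \<in> S"
    and gM: "\<And>y. y \<in> f ` S \<Longrightarrow> norm (g y) \<le> M * norm y"
    and gerr: "\<And>y. y \<in> f ` S \<Longrightarrow> norm (y - f (g y)) \<le> norm y / 2"
    using approx by metis
  define z where "z n = ((\<lambda>u. u - f (g u)) ^^ n) y" for n
  have z0: "z 0 = y" and zSuc: "\<And>n. z (Suc n) = z n - f (g (z n))"
    by (simp_all add: z_def)
  have zY: "z n \<in> f ` S" for n
  proof (induction n)
    case (Suc n)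
    then show ?case
      unfolding zSuc using Y gS by (blast intro: subspace_diff)
  qed (simp add: z0 y)
  have zle: "norm (z n) \<le> norm y * (1/2) ^ n" for n
  proof (induction n)
    case (Suc n)
    then show ?case
      using gerr[OF zY, of n] by (simp add: zSuc)
  qed (simp add: z0)
  define x where "x n = g (z n)" for n
  have M: "0 \<le> M" if "y \<noteq> 0"
  proof -
    have "0 \<le> M * norm y"
      using gM[OF y] norm_ge_zero order_trans by blast
    with that show ?thesis
      by (simp add: zero_le_mult_iff)
  qed
  have xle: "norm (x n) \<le> M * norm y * (1/2) ^ n" for n
  proof (cases "y = 0")
    case True
    then have "z n = 0" using zle[of n] by simp
    with True gM[OF zY, of n] show ?thesis by (simp add: x_def)
  next
    case False
    have "norm (x n) \<le> M * norm (z n)"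
      using gM[OF zY] by (simp add: x_def)
    also have "\<dots> \<le> M * (norm y * (1/2) ^ n)"
      by (rule mult_left_mono[OF zle M[OF False]])
    finally show ?thesis by (simp add: mult.assoc)
  qed
  have geo: "(\<lambda>n. M * norm y * (1/2) ^ n) sums (M * norm y * 2)"
    using sums_mult[OF geometric_sums[of "1/2::real"], of "M * norm y"] by simp
  have sn: "summable (\<lambda>n. norm (x n))"
    by (rule summable_comparison_test'[OF sums_summable[OF geo], of 0]) (simp add: xle)
  then have sx: "summable x"
    by (rule summable_norm_cancel)
  have "suminf x \<in> S"
  proof (rule closed_sequentially[OF S(2)])
    show "(\<Sum>k<n. x k) \<in> S" for n
      by (rule subspace_sum[OF S(1)]) (simp add: x_def gS[OF zY])
    show "(\<lambda>n. \<Sum>k<n. x k) \<longlonglongrightarrow> suminf x"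
      by (rule summable_LIMSEQ[OF sx])
  qed
  moreover have "f (suminf x) = y"
  proof -
    have part: "(\<Sum>k<n. f (x k)) = y - z n" for n
      by (induction n) (simp_all add: z0 zSuc x_def)
    have "(\<lambda>n. norm y * (1/2) ^ n) \<longlonglongrightarrow> norm y * 0"
      by (intro tendsto_mult_left LIMSEQ_power_zero) simp
    then have "z \<longlonglongrightarrow> 0"
      by (intro Lim_null_comparison[of z]) (use zle in auto)
    then have "(\<lambda>n. \<Sum>k<n. f (x k)) \<longlonglongrightarrow> y - 0"
      unfolding part by (intro tendsto_diff tendsto_const)
    moreover have "(\<lambda>n. \<Sum>k<n. f (x k)) \<longlonglongrightarrow> f (suminf x)"
      using f.sums[OF summable_sums[OF sx]] by (simp add: sums_def)
    ultimately show ?thesis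
      using LIMSEQ_unique by fastforce
  qed
  moreover have "norm (suminf x) \<le> 2 * M * norm y"
  proof -
    have "norm (suminf x) \<le> (\<Sum>n. norm (x n))"
      by (rule summable_norm[OF sn])
    also have "\<dots> \<le> (\<Sum>n. M * norm y * (1/2) ^ n)"
      by (rule suminf_le[OF xle sn sums_summable[OF geo]])
    also have "\<dots> = 2 * M * norm y"
      using sums_unique[OF geo] by simp
    finally show ?thesis .
  qed
  ultimately show ?thesis by blast
qed

text \<open>
  The closed sets \<open>closure (f ` (S \<inter> cball 0 n))\<close> cover the complete space \<open>f ` S\<close>, so by Baire
  one of them contains a relatively open ball. The differences of its points then fill a ball
  around the origin, and rescaling gives approximate preimages for every \<open>y\<close>.
\<close>

lemma approximate_preimage_bound:
  fixes f :: "'a::real_normed_vector \<Rightarrow> 'b::banach"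
  assumes f: "bounded_linear f" and S: "subspace S" and closed: "closed (f ` S)"
  shows "\<exists>M. \<forall>y \<in> f ` S. \<exists>x\<in>S. norm x \<le> M * norm y \<and> norm (y - f x) \<le> norm y / 2"
proof -
  interpret f: bounded_linear f by (rule f)
  let ?Y = "f ` S"
  let ?X = "top_of_set ?Y"
  have Y: "subspace ?Y"
    using S f.linear_axioms by (simp add: linear_subspace_image)
  define D where "D n = closure (f ` (S \<inter> cball 0 (real n)))" for n
  have DY: "D n \<subseteq> ?Y" for n
    unfolding D_def by (rule closure_minimal[OF _ closed]) auto
  have cover: "\<Union>(range D) = ?Y"
  proof
    show "?Y \<subseteq> \<Union>(range D)"
    proof
      fix y assume "y \<in> ?Y"
      then obtain x where x: "x \<in> S" "y = f x" by blast
      obtain n where "norm x \<le> real n" using real_arch_simple by blast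
      with x have "y \<in> D n"
        unfolding D_def by (intro subsetD[OF closure_subset]) auto
      then show "y \<in> \<Union>(range D)" by blast
    qed
  qed (use DY in blast)
  have "completely_metrizable_space ?X"
    by (simp add: closed completely_metrizable_space_closedin completely_metrizable_space_euclidean)
  moreover have "?X interior_of \<Union>(range D) \<noteq> {}"
    using subspace_0[OF Y] interior_of_topspace[of ?X] by (auto simp: cover)
  ultimately obtain n where n: "?X interior_of (D n) \<noteq> {}"
    using Baire_category_alt[of ?X "range D"] DY
    by (force simp: D_def closed_subset)
  then obtain y0 where "y0 \<in> ?X interior_of (D n)" by blast
  then obtain U where U: "open U" "y0 \<in> U" "y0 \<in> ?Y" "?Y \<inter> U \<subseteq> D n"
    by (auto simp: interior_of_def openin_open)
  then obtain r where r: "r > 0" "ball y0 r \<subseteq> U"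
    using openE by blast
  \<comment> \<open>Write a small \<open>y\<close> as \<open>(y0 + y) - y0\<close>, a difference of two points of \<open>D n\<close>.\<close>
  have small: "\<exists>x\<in>S. norm x \<le> 2 * real n \<and> norm (y - f x) < e"
    if y: "y \<in> ?Y" "norm y < r" and e: "e > 0" for y e
  proof -
    have "y0 + y \<in> D n"
      using U r y subspace_add[OF Y] by (auto simp: subset_iff dist_norm)
    then obtain a where a: "a \<in> S" "norm a \<le> real n" "dist (f a) (y0 + y) < e/2"
      using e unfolding D_def closure_approachable by (force dest: spec[of _ "e/2"])
    have "y0 \<in> D n" using U by blast
    then obtain b where b: "b \<in> S" "norm b \<le> real n" "dist (f b) y0 < e/2"
      using e unfolding D_def closure_approachable by (force dest: spec[of _ "e/2"])
    have "norm (a - b) \<le> 2 * real n"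
      using a b norm_triangle_ineq4[of a b] by linarith
    moreover have "norm (y - f (a - b)) < e"
    proof -
      have "y - f (a - b) = (f b - y0) - (f a - (y0 + y))"
        by (simp add: f.diff)
      then have "norm (y - f (a - b)) \<le> dist (f b) y0 + dist (f a) (y0 + y)"
        using norm_triangle_ineq4[of "f b - y0" "f a - (y0 + y)"] by (simp only: dist_norm)
      with a(3) b(3) show ?thesis by linarith
    qed
    ultimately show ?thesis
      using a b subspace_diff[OF S] by blast
  qed
  have "\<exists>x\<in>S. norm x \<le> (4 * real n / r) * norm y \<and> norm (y - f x) \<le> norm y / 2"
    if y: "y \<in> ?Y" for y
  proof (cases "y = 0")
    case True
    then show ?thesis
      using subspace_0[OF S] by (intro bexI[of _ 0]) (auto simp: f.zero)
  next
    case False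
    \<comment> \<open>Rescale \<open>y\<close> to norm \<open>r/2\<close>, within the ball just treated.\<close>
    define t where "t = r / (2 * norm y)"
    have t: "t > 0" "t * norm y = r / 2"
      using False r by (simp_all add: t_def)
    have "t *\<^sub>R y \<in> ?Y" "norm (t *\<^sub>R y) < r"
      using y subspace_scale[OF Y] t r by auto
    then obtain x where x: "x \<in> S" "norm x \<le> 2 * real n" "norm (t *\<^sub>R y - f x) < r / 4"
      using small[of "t *\<^sub>R y" "r/4"] r by auto
    have "norm (x /\<^sub>R t) \<le> (4 * real n / r) * norm y"
    proof -
      have "norm (x /\<^sub>R t) = norm x / t"
        using t by (simp add: field_simps)
      also have "\<dots> \<le> 2 * real n / t"
        using x t by (simp add: divide_right_mono)
      also have "\<dots> = (4 * real n / r) * norm y"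
        by (simp add: t_def)
      finally show ?thesis .
    qed
    moreover have "norm (y - f (x /\<^sub>R t)) \<le> norm y / 2"
    proof -
      have eq: "y - f (x /\<^sub>R t) = (t *\<^sub>R y - f x) /\<^sub>R t"
        using t by (simp add: f.scaleR scaleR_diff_right)
      have "norm (y - f (x /\<^sub>R t)) = norm (t *\<^sub>R y - f x) / t"
        unfolding eq norm_scaleR using t by (simp add: field_simps)
      also have "\<dots> \<le> (r / 4) / t"
        using x t by (intro divide_right_mono) auto
      also have "\<dots> = norm y / 2"
        using r by (simp add: t_def)
      finally show ?thesis .
    qed
    ultimately show ?thesis
      using x subspace_scale[OF S] by blast
  qed
  then show ?thesis by blast
qed

theorem open_mapping_closed_image:
  fixes f :: "'a::banach \<Rightarrow> 'b::banach"
  assumes "bounded_linear f" "subspace S" "closed S" "closed (f ` S)"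
  shows "\<exists>C. \<forall>y \<in> f ` S. \<exists>x\<in>S. f x = y \<and> norm x \<le> C * norm y"
proof -
  obtain M where "\<forall>y \<in> f ` S. \<exists>x\<in>S. norm x \<le> M * norm y \<and> norm (y - f x) \<le> norm y / 2"
    using approximate_preimage_bound assms by blast
  then have "\<forall>y \<in> f ` S. \<exists>x\<in>S. f x = y \<and> norm x \<le> 2 * M * norm y"
    using exact_preimage_from_approximate[OF assms(1-3), of M] by blast
  then show ?thesis by blast
qed

section \<open>Closed direct sums\<close>

lemma subspace_direct_sum_unique:
  fixes H K :: "'a::real_vector set"
  assumes "subspace H" "subspace K" "H \<inter> K = {0}"
    and "h \<in> H" "h' \<in> H" "k \<in> K" "k' \<in> K" "h + k = h' + k'"
  shows "h = h'" "k = k'"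
proof -
  have eq: "h - h' = k' - k"
    using assms(8) by (simp add: algebra_simps)
  have "h - h' \<in> H" "k' - k \<in> K"
    using assms by (auto intro: subspace_diff)
  then have "h - h' \<in> H \<inter> K"
    by (simp add: eq)
  then have "h - h' = 0"
    unfolding assms(3) by (rule singletonD)
  then show "h = h'" by simp
  then show "k = k'" using assms(8) by simp
qed

text \<open>
  The open mapping theorem for addition on \<open>H \<times> K\<close>; the preimage that it provides is
  \<open>(h, k)\<close> itself, since the sum is direct.
\<close>

lemma direct_sum_components_bounded:
  fixes H K :: "'a::banach set"
  assumes H: "subspace H" "closed H" and K: "subspace K" "closed K"
    and disj: "H \<inter> K = {0}" and sum: "closed (subspace_sum H K)"
  shows "\<exists>C. \<forall>h\<in>H. \<forall>k\<in>K. norm h \<le> C * norm (h + k) \<and> norm k \<le> C * norm (h + k)"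
proof -
  let ?add = "\<lambda>p::'a \<times> 'a. fst p + snd p"
  have img: "?add ` (H \<times> K) = subspace_sum H K"
    by (force simp: subspace_sum_def)
  have "bounded_linear ?add"
    by (intro bounded_linear_add bounded_linear_fst bounded_linear_snd)
  moreover have "closed (?add ` (H \<times> K))"
    unfolding img by (rule sum)
  ultimately obtain C where
    C: "\<forall>y \<in> ?add ` (H \<times> K). \<exists>p\<in>H \<times> K. ?add p = y \<and> norm p \<le> C * norm y"
    using open_mapping_closed_image[OF _ subspace_Times[OF H(1) K(1)] closed_Times[OF H(2) K(2)]]
    by blast
  have "norm (h, k) \<le> C * norm (h + k)" if "h \<in> H" "k \<in> K" for h k
  proof -
    have "h + k \<in> ?add ` (H \<times> K)"
      using that by force
    with C obtain p where p: "p \<in> H \<times> K" "?add p = h + k" "norm p \<le> C * norm (h + k)"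
      by blast
    then have "fst p \<in> H" "snd p \<in> K" by auto
    then have "fst p = h" "snd p = k"
      using subspace_direct_sum_unique[OF H(1) K(1) disj _ that(1) _ that(2) p(2)] by simp_all
    then have "p = (h, k)" by (simp add: prod_eq_iff)
    with p(3) show ?thesis by simp
  qed
  then have "norm h \<le> C * norm (h + k)" "norm k \<le> C * norm (h + k)" if "h \<in> H" "k \<in> K" for h k
    using order_trans[OF norm_fst_le[of h k]] order_trans[OF norm_snd_le[of k h]] that by simp_all
  then show ?thesis by blast
qed

lemma bounded_linear_scaleC: "bounded_linear (\<lambda>x. c *\<^sub>C x)"
  by (rule bounded_linear_intro[of _ "cmod c"])
    (simp_all add: scaleC_add_right scaleR_eq_scaleC scaleC_scaleC norm_scaleC mult.commute)

lemma scaleC_one: "1 *\<^sub>C x = x"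
  using scaleR_eq_scaleC[of 1 x] by (simp only: scaleR_one of_real_1)

text \<open>
  The sets of values of \<open>p + c *\<^sub>C q\<close> and of \<open>p + d *\<^sub>C q\<close> correspond to each other under the
  homeomorphism \<open>h + k \<mapsto> h + (d / c) *\<^sub>C k\<close> of \<open>H + K\<close>. Concretely, when values of
  \<open>p + c *\<^sub>C q\<close> converge, so do their components in \<open>H\<close> and \<open>K\<close>, hence also the values of
  \<open>p + d *\<^sub>C q\<close> at the same points. The limit of the latter is attained, and uniqueness of the
  components shows that the former limit is attained at the same point.
\<close>

lemma closed_range_rescale_component:
  fixes H K :: "'a::{complex_normed_vector,banach} set" and p q :: "'x \<Rightarrow> 'a"
  assumes H: "subspace H" "closed H" and K: "subspace K" "closed K"
    and Kc: "\<And>c k. k \<in> K \<Longrightarrow> c *\<^sub>C k \<in> K"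
    and disj: "H \<inter> K = {0}" and sum: "closed (subspace_sum H K)"
    and pH: "\<And>x. p x \<in> H" and qK: "\<And>x. q x \<in> K"
    and c: "c \<noteq> 0" and d: "d \<noteq> 0"
    and closed: "closed (range (\<lambda>x. p x + d *\<^sub>C q x))"
  shows "closed (range (\<lambda>x. p x + c *\<^sub>C q x))"
proof -
  obtain C where C: "\<forall>h\<in>H. \<forall>k\<in>K. norm h \<le> C * norm (h + k) \<and> norm k \<le> C * norm (h + k)"
    using direct_sum_components_bounded[OF H K disj sum] by blast
  have "l \<in> range (\<lambda>x. p x + c *\<^sub>C q x)"
    if s: "\<forall>n. s n \<in> range (\<lambda>x. p x + c *\<^sub>C q x)" and l: "s \<longlonglongrightarrow> l" for s l
  proof -
    obtain x where x: "\<And>n. s n = p (x n) + c *\<^sub>C q (x n)"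
      using s[unfolded image_iff] by metis
    have "s n \<in> subspace_sum H K" for n
      unfolding x subspace_sum_def using pH Kc[OF qK] by blast
    then have "l \<in> subspace_sum H K"
      by (rule closed_sequentially[OF sum _ l])
    then obtain h k where hk: "h \<in> H" "k \<in> K" "l = h + k"
      by (auto simp: subspace_sum_def)
    have diff: "s n - l = (p (x n) - h) + (c *\<^sub>C q (x n) - k)" for n
      by (simp add: x hk algebra_simps)
    have mem: "p (x n) - h \<in> H" "c *\<^sub>C q (x n) - k \<in> K" for n
      by (rule subspace_diff[OF H(1) pH hk(1)], rule subspace_diff[OF K(1) Kc[OF qK] hk(2)])
    have "(\<lambda>n. norm (s n - l)) \<longlonglongrightarrow> 0"
      using l by (simp add: LIM_zero tendsto_norm_zero)
    then have lim0: "(\<lambda>n. C * norm (s n - l)) \<longlonglongrightarrow> 0"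
      by (rule tendsto_mult_right_zero)
    have "(\<lambda>n. p (x n) - h) \<longlonglongrightarrow> 0"
      by (rule Lim_null_comparison[OF _ lim0]) (simp add: diff C mem)
    then have limp: "(\<lambda>n. p (x n)) \<longlonglongrightarrow> h"
      by (rule LIM_zero_cancel)
    have "(\<lambda>n. c *\<^sub>C q (x n) - k) \<longlonglongrightarrow> 0"
      by (rule Lim_null_comparison[OF _ lim0]) (simp add: diff C mem)
    then have "(\<lambda>n. c *\<^sub>C q (x n)) \<longlonglongrightarrow> k"
      by (rule LIM_zero_cancel)
    then have "(\<lambda>n. (d / c) *\<^sub>C c *\<^sub>C q (x n)) \<longlonglongrightarrow> (d / c) *\<^sub>C k"
      by (rule bounded_linear.tendsto[OF bounded_linear_scaleC])
    then have "(\<lambda>n. p (x n) + d *\<^sub>C q (x n)) \<longlonglongrightarrow> h + (d / c) *\<^sub>C k"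
      using limp c by (intro tendsto_add) (simp_all add: scaleC_scaleC)
    then have "h + (d / c) *\<^sub>C k \<in> range (\<lambda>x. p x + d *\<^sub>C q x)"
      by (rule closed_sequentially[OF closed rangeI])
    then obtain u where u: "h + (d / c) *\<^sub>C k = p u + d *\<^sub>C q u" by blast
    have "h = p u" "(d / c) *\<^sub>C k = d *\<^sub>C q u"
      by (rule subspace_direct_sum_unique[OF H(1) K(1) disj hk(1) pH Kc[OF hk(2)] Kc[OF qK] u])+
    then have "(c / d) *\<^sub>C (d / c) *\<^sub>C k = (c / d) *\<^sub>C d *\<^sub>C q u" by simp
    then have "k = c *\<^sub>C q u"
      using c d by (simp add: scaleC_scaleC scaleC_one)
    with \<open>h = p u\<close> hk(3) have "l = p u + c *\<^sub>C q u" by simp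
    then show ?thesis by (rule range_eqI)
  qed
  then show ?thesis
    unfolding closed_sequential_limits by blast
qed

section \<open>Orthogonally complemented submodules\<close>

lemma submodule_subspace:
  fixes act :: "'e::complex_normed_vector \<Rightarrow> 'a \<Rightarrow> 'e"
  assumes "submodule act M"
  shows "subspace M"
  using assms by (simp add: submodule_def subspace_def scaleR_eq_scaleC)

context hilbert_cstar_module
begin

lemma ip_add_left: "ip (x + y) z = ip x z + ip y z"
  by (metis ip_add_right ip_star star_add)

lemma ip_minus_right: "ip x (- y) = - ip x y"
  using ip_scaleC_right[of x "of_real (-1)" y] by (simp only: scaleR_eq_scaleC[symmetric] scaleR_minus1_left)

lemma ip_minus_left: "ip (- x) y = - ip x y"
proof -
  have "ip (- x) y + ip x y = ip 0 y"
    by (metis add.left_inverse ip_add_left)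
  moreover have "ip 0 y = 0"
    using ip_add_left[of 0 0 y] by simp
  ultimately show ?thesis
    by (simp add: eq_neg_iff_add_eq_0)
qed

lemma orthogonal_norm_diff_eq_add:
  assumes "ip x y = 0"
  shows "norm (x - y) = norm (x + y)"
proof -
  have "star (0::'a) = 0"
    using star_add[of "0::'a" 0] by simp
  then have yx: "ip y x = 0"
    using ip_star[of x y] assms by simp
  have "ip (x - y) (x - y) = ip (x + y) (x + y)"
    unfolding diff_conv_add_uminus ip_add_left ip_add_right ip_minus_left ip_minus_right
    by (simp add: assms yx)
  then show ?thesis
    by (simp add: norm_eq_ip)
qed

text \<open>
  A limit of elements of \<open>M\<close> differs from some element of \<open>M\<close> by a vector \<open>g\<close> orthogonal to
  \<open>M\<close>, so \<open>g\<close> is itself a limit of elements \<open>u n\<close> of \<open>M\<close>. By orthogonality \<open>g + u n\<close> is as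
  short as \<open>g - u n\<close>; the former tends to \<open>2 g\<close> and the latter to \<open>0\<close>.
\<close>

lemma orth_complemented_closed:
  assumes "orth_complemented act ip M"
  shows "closed M"
proof -
  have M: "subspace M" and dec: "\<And>l. l \<in> subspace_sum M (orth_compl ip M)"
    using assms submodule_subspace by (auto simp: orth_complemented_def)
  have "l \<in> M" if s: "\<forall>n. s n \<in> M" and l: "s \<longlonglongrightarrow> l" for s l
  proof -
    obtain m g where m: "m \<in> M" and g: "g \<in> orth_compl ip M" and lmg: "l = m + g"
      using dec[of l] by (auto simp: subspace_sum_def)
    define u where "u n = s n - m" for n
    have u: "u \<longlonglongrightarrow> g"
      unfolding u_def using tendsto_diff[OF l tendsto_const[of m]] by (simp add: lmg)
    have "u n \<in> M" for n
      using s m M by (simp add: u_def subspace_diff)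
    then have eq: "norm (g - u n) = norm (g + u n)" for n
      using g by (intro orthogonal_norm_diff_eq_add) (simp add: orth_compl_def)
    have "(\<lambda>n. norm (g - u n)) \<longlonglongrightarrow> norm (g - g)"
      by (intro tendsto_intros u)
    moreover have "(\<lambda>n. norm (g - u n)) \<longlonglongrightarrow> norm (g + g)"
      unfolding eq by (intro tendsto_intros u)
    ultimately have "norm (g + g) = norm (g - g)"
      using LIMSEQ_unique by blast
    then have "g = 0"
      by (simp flip: scaleR_2)
    with m lmg show ?thesis by simp
  qed
  then show ?thesis
    unfolding closed_sequential_limits by blast
qed

end

section \<open>Closed ranges of combinations of idempotents\<close>

theorem theorem2p3:
  fixes act :: "'e::{complex_normed_vector,banach} \<Rightarrow> 'a::cstar_algebra \<Rightarrow> 'e"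
    and ip :: "'e \<Rightarrow> 'e \<Rightarrow> 'a"
    and H K :: "'e set"
    and P1 P2 :: "'e \<Rightarrow> 'e"
  assumes "hilbert_cstar_module act ip"
    and "orth_complemented act ip H" and "orth_complemented act ip K"
    and "separated_pair act ip H K"
    and "adjointable ip P1" and "idempotent P1" and "range P1 = H"
    and "adjointable ip P2" and "idempotent P2" and "range P2 = K"
  shows "((\<forall>c::complex. closed (range (\<lambda>x. P1 x + c *\<^sub>C P2 x))) \<longleftrightarrow>
          (\<exists>c::complex. c \<noteq> 0 \<and> closed (range (\<lambda>x. P1 x + c *\<^sub>C P2 x)))) \<and>
         ((\<exists>c::complex. c \<noteq> 0 \<and> closed (range (\<lambda>x. P1 x + c *\<^sub>C P2 x))) \<longleftrightarrow>
          closed (range (\<lambda>x. P1 x + P2 x)))"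
proof -
  have subH: "submodule act H" and subK: "submodule act K"
    and cl: "closed H" "closed K" and disj: "H \<inter> K = {0}"
    and oc: "orth_complemented act ip (subspace_sum H K)"
    using assms(4) by (auto simp: separated_pair_def)
  have sum: "closed (subspace_sum H K)"
    by (rule hilbert_cstar_module.orth_complemented_closed[OF assms(1) oc])
  have H: "subspace H" "closed H" and K: "subspace K" "closed K"
    using subH subK cl submodule_subspace by auto
  have Kc: "\<And>c k. k \<in> K \<Longrightarrow> c *\<^sub>C k \<in> K"
    using subK by (simp add: submodule_def)
  let ?R = "\<lambda>c. range (\<lambda>x. P1 x + c *\<^sub>C P2 x)"
  have rescale: "closed (?R c)" if "c \<noteq> 0" "d \<noteq> 0" "closed (?R d)" for c d
    using closed_range_rescale_component[OF H K Kc disj sum, of P1 P2] assms(7,10) that by blast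
  have zero: "closed (?R 0)"
  proof -
    have "0 *\<^sub>C y = 0" for y :: 'e
      using scaleR_eq_scaleC[of 0 y] by simp
    with H(2) assms(7) show ?thesis by simp
  qed
  have one: "closed (range (\<lambda>x. P1 x + P2 x)) \<longleftrightarrow> closed (?R 1)"
    by (simp add: scaleC_one)
  show ?thesis
    unfolding one using rescale zero zero_neq_one by metis
qed

end
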